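(* Let $S$ be an infinite set of primes and $\langle r_p : p \in S\rangle$ a sequence of positive integers, and let $G = \bigoplus_{p \in S} (\mathbb{Z}/p\mathbb{Z})^{r_p}$. Then $\mathrm{Th}(G,+)$ does not have the Schröder–Bernstein property; moreover, there exist two reduced models of $\mathrm{Th}(G,+)$ that are elementarily bi-embeddable but not isomorphic.
   Context: A complete theory $T$ has the Schröder–Bernstein property if any two elementarily bi-embeddable models of $T$ are isomorphic. An abelian group is reduced if it has no nonzero divisible subgroup. *)

theory Defs
  imports "HOL-Algebra.Product_Groups" "HOL-Computational_Algebra.Primes"
begin

section \<open>First-order logic in the language with one binary function symbol\<close>

text \<open>
  Structures are records of type \<^typ>\<open>'a monoid\<close>, whose multiplication interprets the symbol
  written \<open>+\<close> informally. The field \<^const>\<open>one\<close> of the record is not part of the signature: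
  nothing in this section (nor \<^const>\<open>hom\<close> and \<^const>\<open>is_iso\<close> in the library) refers to it.
\<close>

datatype tm = Var nat | Plus tm tm

datatype fm = Eq tm tm | Neg fm | Conj fm fm | Exi nat fm

fun tm_vars :: "tm \<Rightarrow> nat set" where
  "tm_vars (Var x) = {x}"
| "tm_vars (Plus s t) = tm_vars s \<union> tm_vars t"

fun free_vars :: "fm \<Rightarrow> nat set" where
  "free_vars (Eq s t) = tm_vars s \<union> tm_vars t"
| "free_vars (Neg \<phi>) = free_vars \<phi>"
| "free_vars (Conj \<phi> \<psi>) = free_vars \<phi> \<union> free_vars \<psi>"
| "free_vars (Exi x \<phi>) = free_vars \<phi> - {x}"

definition sentence :: "fm \<Rightarrow> bool" where
  "sentence \<phi> \<longleftrightarrow> free_vars \<phi> = {}"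

fun tm_val :: "'a monoid \<Rightarrow> (nat \<Rightarrow> 'a) \<Rightarrow> tm \<Rightarrow> 'a" where
  "tm_val M e (Var x) = e x"
| "tm_val M e (Plus s t) = tm_val M e s \<otimes>\<^bsub>M\<^esub> tm_val M e t"

fun sat :: "'a monoid \<Rightarrow> (nat \<Rightarrow> 'a) \<Rightarrow> fm \<Rightarrow> bool" where
  "sat M e (Eq s t) \<longleftrightarrow> tm_val M e s = tm_val M e t"
| "sat M e (Neg \<phi>) \<longleftrightarrow> \<not> sat M e \<phi>"
| "sat M e (Conj \<phi> \<psi>) \<longleftrightarrow> sat M e \<phi> \<and> sat M e \<psi>"
| "sat M e (Exi x \<phi>) \<longleftrightarrow> (\<exists>a\<in>carrier M. sat M (e(x := a)) \<phi>)"

definition fo_structure :: "'a monoid \<Rightarrow> bool" where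
  "fo_structure M \<longleftrightarrow> carrier M \<noteq> {} \<and>
     (\<forall>a\<in>carrier M. \<forall>b\<in>carrier M. a \<otimes>\<^bsub>M\<^esub> b \<in> carrier M)"

definition holds :: "'a monoid \<Rightarrow> fm \<Rightarrow> bool" where
  "holds M \<phi> \<longleftrightarrow> (\<forall>e. range e \<subseteq> carrier M \<longrightarrow> sat M e \<phi>)"

definition Th :: "'a monoid \<Rightarrow> fm set" where
  "Th M = {\<phi>. sentence \<phi> \<and> holds M \<phi>}"

definition model_of :: "fm set \<Rightarrow> 'a monoid \<Rightarrow> bool" where
  "model_of T M \<longleftrightarrow> fo_structure M \<and> (\<forall>\<phi>\<in>T. holds M \<phi>)"

definition elementary_embedding :: "'a monoid \<Rightarrow> 'b monoid \<Rightarrow> ('a \<Rightarrow> 'b) \<Rightarrow> bool" where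
  "elementary_embedding M N f \<longleftrightarrow> f \<in> carrier M \<rightarrow> carrier N \<and>
     (\<forall>\<phi> e. range e \<subseteq> carrier M \<longrightarrow> (sat M e \<phi> \<longleftrightarrow> sat N (f \<circ> e) \<phi>))"

definition elementarily_biembeddable :: "'a monoid \<Rightarrow> 'b monoid \<Rightarrow> bool" where
  "elementarily_biembeddable M N \<longleftrightarrow>
     (\<exists>f. elementary_embedding M N f) \<and> (\<exists>g. elementary_embedding N M g)"

text \<open>
  HOL cannot quantify over types inside a formula, so the models range over the structures whose
  carrier is a subset of a universe given by the type argument. A universe of at least continuum
  size contains a copy of every reduced model of the theory of a direct sum of groups
  $(Z/pZ)^{r_p}$ over distinct primes $p$, since such a model embeds in the direct product.
\<close>

definition schroeder_bernstein :: "'u itself \<Rightarrow> fm set \<Rightarrow> bool" where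
  "schroeder_bernstein _ T \<longleftrightarrow>
     (\<forall>(M :: 'u monoid) (N :: 'u monoid).
        model_of T M \<longrightarrow> model_of T N \<longrightarrow> elementarily_biembeddable M N \<longrightarrow> M \<cong> N)"

section \<open>Abelian groups\<close>

definition divisible_subgroup :: "'a set \<Rightarrow> 'a monoid \<Rightarrow> bool" where
  "divisible_subgroup H M \<longleftrightarrow> subgroup H M \<and>
     (\<forall>n::nat. n > 0 \<longrightarrow> (\<forall>x\<in>H. \<exists>y\<in>H. y [^]\<^bsub>M\<^esub> n = x))"

definition reduced_group :: "'a monoid \<Rightarrow> bool" where
  "reduced_group M \<longleftrightarrow> comm_group M \<and>
     \<not> (\<exists>H. divisible_subgroup H M \<and> H \<noteq> {\<one>\<^bsub>M\<^esub>})"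

definition prime_sum_group :: "nat set \<Rightarrow> (nat \<Rightarrow> nat) \<Rightarrow> (nat \<Rightarrow> nat \<Rightarrow> int) monoid" where
  "prime_sum_group S r =
     sum_group S (\<lambda>p. product_group {..<r p} (\<lambda>_. integer_mod_group p))"

end

theory Submission
  imports Defs "HOL-Computational_Algebra.Polynomial" "HOL-Number_Theory.Cong"
    "HOL-Library.Discrete_Functions" "HOL-Real_Asymp.Real_Asymp"
begin

text \<open>
  Let $P$ be the direct product of the groups $(Z/pZ)^{r_p}$ and $G$ their direct sum. The quotient
  $P/G$ is a $Q$-vector space, and if $G \subseteq A \subseteq B \subseteq P$ with $A/G$ and $B/G$ subspaces,
  then $A$ is an elementary substructure of $B$, by a back-and-forth argument in which each formula
  only sees finitely many components and integer relations with bounded coefficients. In particular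
  all these groups are models of the theory of $G$, and they are reduced.

  Let $x_p$ be the integer part of the binary logarithm of $p$. For every nonzero integer polynomial
  $f$ the residue of $f(x_p)$ modulo $p$ is nonzero for almost all $p$, so $x$, viewed as a vector
  with constant entries in each component, is transcendental over $Q$ in $P/G$. Let $A$ be the
  preimage of $Q[x]$ and $B$ the preimage of the span of $1, x^2, x^3, \dots$ Then $B \subseteq A$ and
  $x^2 A \subseteq B$ yield elementary embeddings both ways. Every homomorphism between such groups
  commutes with multiplication by $x$, but $A$ is closed under this multiplication while $B$ is not,
  since it contains $1$ and not $x$; so $A$ and $B$ are not isomorphic.
\<close>

section \<open>Elementary embeddings\<close>

lemma tm_val_closed:
  assumes "fo_structure M" "range e \<subseteq> carrier M"
  shows "tm_val M e t \<in> carrier M"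
  using assms by (induction t) (auto simp: fo_structure_def)

lemma tm_val_hom:
  assumes "fo_structure M" "h \<in> hom M N" "range e \<subseteq> carrier M"
  shows "tm_val N (h \<circ> e) t = h (tm_val M e t)"
  using tm_val_closed[OF assms(1,3)] assms(2) by (induction t) (simp_all add: hom_mult)

text \<open>Injectivity of \<open>h\<close> reflects equations; surjectivity lets every quantifier
  witness in \<open>N\<close> be pulled back to \<open>M\<close>.\<close>

lemma sat_iso:
  assumes "fo_structure M" "h \<in> iso M N" "range e \<subseteq> carrier M"
  shows "sat N (h \<circ> e) \<phi> \<longleftrightarrow> sat M e \<phi>"
  using assms(3)
proof (induction \<phi> arbitrary: e)
  case (Eq s t)
  have "inj_on h (carrier M)" and hom: "h \<in> hom M N"
    using assms(2) by (simp_all add: iso_iff)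
  then show ?case
    using tm_val_closed[OF assms(1) Eq] tm_val_hom[OF assms(1) hom Eq] by (simp only: sat.simps inj_on_eq_iff)
next
  case (Exi x \<phi>)
  define Q where "Q b \<longleftrightarrow> sat N ((h \<circ> e)(x := b)) \<phi>" for b
  have "Q (h a) \<longleftrightarrow> sat M (e(x := a)) \<phi>" if "a \<in> carrier M" for a
  proof -
    have "(h \<circ> e)(x := h a) = h \<circ> e(x := a)" by auto
    moreover have "range (e(x := a)) \<subseteq> carrier M" using Exi.prems that by auto
    ultimately show ?thesis using Exi.IH by (simp only: Q_def)
  qed
  moreover have "carrier N = h ` carrier M"
    using assms(2) by (simp add: iso_iff)
  ultimately show ?case unfolding sat.simps Q_def[symmetric] by auto
qed simp_all

lemma elementary_embedding_iso:
  assumes "fo_structure M" "h \<in> iso M N"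
  shows "elementary_embedding M N h"
  using sat_iso[OF assms] assms(2) by (auto simp: elementary_embedding_def iso_iff hom_def)

lemma elementary_embedding_trans:
  assumes "elementary_embedding L M f" "elementary_embedding M N g"
  shows "elementary_embedding L N (g \<circ> f)"
proof -
  have "sat L e \<phi> \<longleftrightarrow> sat N (g \<circ> f \<circ> e) \<phi>" if "range e \<subseteq> carrier L" for e \<phi>
  proof -
    have "range (f \<circ> e) \<subseteq> carrier M" using that assms(1) by (auto simp: elementary_embedding_def)
    then show ?thesis using assms that by (simp add: elementary_embedding_def comp_assoc)
  qed
  then show ?thesis using assms by (auto simp: elementary_embedding_def)
qed

lemma tm_val_cong: "(\<And>x. x \<in> tm_vars t \<Longrightarrow> e x = e' x) \<Longrightarrow> tm_val M e t = tm_val M e' t"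
  by (induction t) auto

lemma sat_cong: "(\<And>x. x \<in> free_vars \<phi> \<Longrightarrow> e x = e' x) \<Longrightarrow> sat M e \<phi> \<longleftrightarrow> sat M e' \<phi>"
proof (induction \<phi> arbitrary: e e')
  case (Eq s t)
  have "tm_val M e s = tm_val M e' s" "tm_val M e t = tm_val M e' t"
    by (rule tm_val_cong; use Eq in simp)+
  then show ?case by simp
next
  case (Exi x \<phi>)
  have "sat M (e(x := a)) \<phi> \<longleftrightarrow> sat M (e'(x := a)) \<phi>" for a
    by (rule Exi.IH) (use Exi.prems in auto)
  then show ?case by simp
next
  case (Conj \<phi> \<psi>)
  have "sat M e \<phi> \<longleftrightarrow> sat M e' \<phi>" "sat M e \<psi> \<longleftrightarrow> sat M e' \<psi>"
    by (rule Conj.IH; use Conj.prems in simp)+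
  then show ?case by simp
next
  case (Neg \<phi>)
  have "sat M e \<phi> \<longleftrightarrow> sat M e' \<phi>"
    by (rule Neg.IH) (use Neg.prems in simp)
  then show ?case by simp
qed

text \<open>A sentence ignores its valuation, so its truth is read off at one constant valuation of
  \<open>M\<close>, pushed along \<open>f\<close>, and moved from there to any valuation of
  \<open>N\<close>.\<close>

lemma model_of_Th_elementary_embedding:
  assumes "fo_structure M" "fo_structure N" "elementary_embedding M N f"
  shows "model_of (Th M) N"
proof -
  obtain a where a: "a \<in> carrier M" using assms(1) by (auto simp: fo_structure_def)
  have "sat N e \<phi>" if "\<phi> \<in> Th M" for \<phi> e
  proof -
    have "sat M (\<lambda>_. a) \<phi>" using that a by (auto simp: Th_def holds_def)
    then have "sat N (f \<circ> (\<lambda>_. a)) \<phi>"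
      using assms(3) a by (auto simp: elementary_embedding_def)
    then show ?thesis
      using sat_cong[of \<phi> e "f \<circ> (\<lambda>_. a)" N] that by (simp add: Th_def sentence_def)
  qed
  then show ?thesis using assms(2) by (simp add: model_of_def holds_def)
qed

section \<open>Transport of structure along an injection\<close>

definition transport :: "('a \<Rightarrow> 'b) \<Rightarrow> 'a monoid \<Rightarrow> 'b monoid" where
  "transport g M = \<lparr>carrier = g ` carrier M, monoid.mult = (\<lambda>a b. g (inv_into UNIV g a \<otimes>\<^bsub>M\<^esub> inv_into UNIV g b)), one = g \<one>\<^bsub>M\<^esub>\<rparr>"

lemma carrier_transport: "carrier (transport g M) = g ` carrier M"
  by (simp add: transport_def)

lemma transport_iso: "inj g \<Longrightarrow> g \<in> iso M (transport g M)"
  by (auto simp: iso_iff hom_def transport_def inj_def inj_on_def)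

lemma fo_structure_transport: "inj g \<Longrightarrow> fo_structure M \<Longrightarrow> fo_structure (transport g M)"
  by (auto simp: fo_structure_def transport_def)

lemma fo_structure_group:
  assumes "group M" shows "fo_structure M"
proof -
  interpret group M by fact
  show ?thesis using one_closed by (auto simp: fo_structure_def)
qed

lemma comm_group_transport:
  assumes "inj g" "comm_group M"
  shows "comm_group (transport g M)"
proof -
  interpret comm_group M by fact
  show ?thesis
  proof (rule comm_groupI)
    fix a assume "a \<in> carrier (transport g M)"
    then obtain x where x: "x \<in> carrier M" "a = g x" by (auto simp: transport_def)
    show "\<exists>b\<in>carrier (transport g M). b \<otimes>\<^bsub>transport g M\<^esub> a = \<one>\<^bsub>transport g M\<^esub>"
      by (rule bexI[of _ "g (inv\<^bsub>M\<^esub> x)"]) (use x assms(1) in \<open>auto simp: transport_def\<close>)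
  qed (use assms(1) in \<open>auto simp: transport_def m_ac\<close>)
qed

lemma transport_pow:
  assumes "inj g" shows "g x [^]\<^bsub>transport g M\<^esub> (n::nat) = g (x [^]\<^bsub>M\<^esub> n)"
  using assms by (induction n) (simp_all add: transport_def)

text \<open>The preimage under \<open>g\<close> of a divisible subgroup is divisible, hence trivial;
  as \<open>g\<close> is onto the transported carrier, the subgroup itself is trivial.\<close>

lemma reduced_group_transport:
  assumes "inj g" "reduced_group M"
  shows "reduced_group (transport g M)"
proof -
  let ?N = "transport g M"
  interpret M: comm_group M using assms(2) by (simp add: reduced_group_def)
  interpret N: comm_group ?N using comm_group_transport[OF assms(1) M.comm_group_axioms] .
  interpret gh: group_hom M ?N g
    using transport_iso[OF assms(1)] by unfold_locales (simp add: iso_iff)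
  have "K = {\<one>\<^bsub>?N\<^esub>}" if K: "divisible_subgroup K ?N" for K
  proof -
    let ?H = "{x \<in> carrier M. g x \<in> K}"
    have sub: "subgroup K ?N" using K by (simp add: divisible_subgroup_def)
    have K_sub: "K \<subseteq> g ` carrier M" using subgroup.subset[OF sub] by (simp only: carrier_transport)
    have "subgroup ?H M"
    proof (rule M.subgroupI)
      have "\<one>\<^bsub>M\<^esub> \<in> ?H" using subgroup.one_closed[OF sub] by simp
      then show "?H \<noteq> {}" by blast
    qed (auto simp: subgroup.m_closed[OF sub] subgroup.m_inv_closed[OF sub])
    moreover have "\<exists>y\<in>?H. y [^]\<^bsub>M\<^esub> n = x" if "n > 0" "x \<in> ?H" for n :: nat and x
    proof -
      obtain b where "b \<in> K" "b [^]\<^bsub>?N\<^esub> n = g x"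
        using K \<open>n > 0\<close> \<open>x \<in> ?H\<close> by (auto simp: divisible_subgroup_def)
      moreover obtain y where "y \<in> carrier M" "b = g y" using K_sub \<open>b \<in> K\<close> by blast
      ultimately show ?thesis
        using transport_pow[OF assms(1)] assms(1) by (auto simp: inj_eq)
    qed
    ultimately have "divisible_subgroup ?H M" by (simp add: divisible_subgroup_def)
    then have "?H = {\<one>\<^bsub>M\<^esub>}" using assms(2) by (auto simp: reduced_group_def)
    moreover have "K = g ` ?H" using K_sub by auto
    ultimately show ?thesis by simp
  qed
  then show ?thesis using N.comm_group_axioms by (auto simp: reduced_group_def)
qed

text \<open>A function is coded by its graph, which \<open>to_nat\<close> turns into a set of
  naturals.\<close>

lemma inj_integer_functions:
  assumes "(UNIV :: nat set set) \<lesssim> (UNIV :: 'u set)"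
  shows "\<exists>g :: (nat \<Rightarrow> nat \<Rightarrow> int) \<Rightarrow> 'u. inj g"
proof -
  obtain c :: "nat set \<Rightarrow> 'u" where c: "inj c" using assms by (auto simp: lepoll_def)
  let ?graph = "\<lambda>f :: nat \<Rightarrow> nat \<Rightarrow> int. {to_nat (p, j, f p j) | p j. True}"
  have "inj ?graph"
  proof (rule injI)
    fix f h :: "nat \<Rightarrow> nat \<Rightarrow> int" assume eq: "?graph f = ?graph h"
    have "f p j = h p j" for p j
    proof -
      have "to_nat (p, j, f p j) \<in> ?graph h" using eq by blast
      then show ?thesis by auto
    qed
    then show "f = h" by blast
  qed
  then have "inj (c \<circ> ?graph)" by (rule inj_compose[OF c])
  then show ?thesis by blast
qed

section \<open>Logarithms as a transcendental sequence of residues\<close>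

text \<open>Each Horner step raises the exponent by one, and for \<open>x \<ge> 1\<close> the new
  constant is absorbed by the leading power.\<close>

lemma poly_int_growth:
  fixes f :: "int poly"
  shows "\<exists>C d. \<forall>x\<ge>1. \<bar>poly f x\<bar> \<le> C * x ^ d"
proof (induction f)
  case 0
  then show ?case by (intro exI[of _ 0]) auto
next
  case (pCons a f)
  then obtain C d where Cd: "\<And>x. x \<ge> 1 \<Longrightarrow> \<bar>poly f x\<bar> \<le> C * x ^ d" by blast
  have "\<bar>poly (pCons a f) x\<bar> \<le> (\<bar>a\<bar> + C) * x ^ Suc d" if "x \<ge> 1" for x
  proof -
    have "\<bar>poly (pCons a f) x\<bar> \<le> \<bar>a\<bar> + x * \<bar>poly f x\<bar>"
      using that abs_triangle_ineq[of a "x * poly f x"] by (simp add: abs_mult)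
    also have "\<dots> \<le> \<bar>a\<bar> * x ^ Suc d + x * (C * x ^ d)"
      using that Cd[OF that] one_le_power[of x "Suc d"]
      by (intro add_mono mult_left_mono) (auto simp: mult_le_cancel_left1)
    finally show ?thesis by (simp add: algebra_simps)
  qed
  then show ?case by blast
qed

text \<open>With \<open>m = floor_log p\<close>, the value of \<open>f\<close> at \<open>m\<close>
  grows polynomially in \<open>m\<close>, while \<open>p \<ge> 2 ^ m\<close>. For large
  \<open>p\<close> it is therefore nonzero and smaller than \<open>p\<close> in absolute
  value.\<close>

lemma floor_log_transcendental:
  fixes f :: "int poly"
  assumes "f \<noteq> 0"
  shows "\<exists>N. \<forall>p>N. \<not> int p dvd poly f (int (floor_log p))"
proof -
  obtain C d where Cd: "\<And>x. x \<ge> 1 \<Longrightarrow> \<bar>poly f x\<bar> \<le> C * x ^ d"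
    using poly_int_growth by blast
  have "(\<lambda>m::nat. real_of_int C * real m ^ d / 2 ^ m) \<longlonglongrightarrow> 0" by real_asymp
  then have "\<forall>\<^sub>F m in sequentially. real_of_int C * real m ^ d / 2 ^ m < 1"
    by (rule order_tendstoD) simp
  then obtain m0 where m0: "\<And>m. m \<ge> m0 \<Longrightarrow> real_of_int C * real m ^ d / 2 ^ m < 1"
    by (auto simp: eventually_sequentially)
  have "finite {m. poly f (int m) = 0}"
    using finite_vimageI[OF poly_roots_finite[OF assms] inj_of_nat] by (simp add: vimage_def)
  then obtain m1 where m1: "\<And>m. m > m1 \<Longrightarrow> poly f (int m) \<noteq> 0"
    by (metis (mono_tags, lifting) finite_nat_set_iff_bounded_le linorder_not_less mem_Collect_eq)
  \<comment> \<open>The exponent puts \<open>floor_log p\<close> at least at \<open>m0\<close>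
    (comparison with powers of 2), above \<open>m1\<close> (no roots) and at least at 1 (for
    \<open>Cd\<close>).\<close>
  have "\<not> int p dvd poly f (int (floor_log p))" if p: "p > 2 ^ (m0 + m1 + 1)" for p
  proof
    let ?m = "floor_log p"
    have m: "m0 + m1 + 1 \<le> ?m" using floor_log_le_iff[of "2 ^ (m0 + m1 + 1)" p] p by simp
    assume "int p dvd poly f (int ?m)"
    moreover have "poly f (int ?m) \<noteq> 0" using m1[of ?m] m by simp
    ultimately have "int p \<le> \<bar>poly f (int ?m)\<bar>" by (simp add: zdvd_imp_le)
    also have "\<dots> \<le> C * int ?m ^ d" using Cd[of "int ?m"] m by simp
    finally have "real p \<le> real_of_int (C * int ?m ^ d)" by linarith
    also have "\<dots> < 2 ^ ?m" using m0[of ?m] m by simp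
    also have "\<dots> \<le> real p"
      using floor_log_exp2_le[of p] p by (metis gr_implies_not0 neq0_conv numeral_power_le_of_nat_cancel_iff)
    finally show False by simp
  qed
  then show ?thesis by blast
qed

section \<open>Isolated subgroups of the product\<close>

lemma dvd_solve:
  fixes a b p :: int
  assumes "prime p" "\<not> p dvd a"
  shows "\<exists>y. p dvd a * y + b"
proof -
  have "coprime a p" using prime_imp_coprime[OF assms] by (simp add: coprime_commute)
  then obtain z where "[a * z = 1] (mod p)" using cong_solve_coprime_int by blast
  then have "p dvd b * (1 - a * z)" by (metis cong_iff_dvd_diff cong_sym dvd_mult)
  then have "p dvd a * (- (z * b)) + b" by (simp add: algebra_simps)
  then show ?thesis by blast
qed

text \<open>Coordinates of \<open>red u\<close> carry a \<open>mod\<close>; these rules strip it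
  inside a divisibility.\<close>

lemma dvd_mod_diff_iff:
  fixes m a b c :: int
  shows "m dvd a mod m - b \<longleftrightarrow> m dvd a - b" "m dvd a * (b mod m) + c \<longleftrightarrow> m dvd a * b + c"
proof -
  show "m dvd a mod m - b \<longleftrightarrow> m dvd a - b" by (simp add: dvd_eq_mod_eq_0 mod_simps)
  have "(a * (b mod m) + c) mod m = (a * b + c) mod m"
    by (rule mod_add_cong) (simp_all add: mod_mult_right_eq)
  then show "m dvd a * (b mod m) + c \<longleftrightarrow> m dvd a * b + c" by (simp add: dvd_eq_mod_eq_0)
qed

lemma dvd_iff_of_dvd_diff: "m dvd a - b \<Longrightarrow> m dvd a \<longleftrightarrow> m dvd b" for m a b :: int
  using dvd_add_right_iff[of m "a - b" b] by simp

lemma eq_of_dvd_diff: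
  fixes a b m :: int
  assumes "0 \<le> a" "a < m" "0 \<le> b" "b < m" "m dvd a - b"
  shows "a = b"
  using assms by (metis mod_eq_dvd_iff mod_pos_pos_trivial)

text \<open>In an abelian group a term denotes an integer linear form; this is its coefficient at
  the variable \<open>i\<close>.\<close>

fun occurrences :: "tm \<Rightarrow> nat \<Rightarrow> int" where
  "occurrences (Var x) i = (if i = x then 1 else 0)"
| "occurrences (Plus s t) i = occurrences s i + occurrences t i"

lemma occurrences_bounded: "\<exists>N. \<forall>i. \<bar>occurrences t i\<bar> \<le> int N"
proof (induction t)
  case (Plus s t)
  then obtain K L where "\<And>i. \<bar>occurrences s i\<bar> \<le> int K" "\<And>i. \<bar>occurrences t i\<bar> \<le> int L" by blast
  then have "\<bar>occurrences (Plus s t) i\<bar> \<le> int (K + L)" for i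
    unfolding occurrences.simps of_nat_add by (intro order_trans[OF abs_triangle_ineq] add_mono)
  then show ?case by blast
qed (auto intro: exI[of _ 1])

lemma finite_tm_vars [simp]: "finite (tm_vars t)"
  by (induction t) auto

lemma finite_free_vars [simp]: "finite (free_vars \<phi>)"
  by (induction \<phi>) auto

section \<open>The product group and the subgroups between sum and product\<close>

locale prime_family =
  fixes S :: "nat set" and r :: "nat \<Rightarrow> nat"
  assumes infinite_S: "infinite S"
    and prime_S: "p \<in> S \<Longrightarrow> prime p"
    and r_pos: "p \<in> S \<Longrightarrow> r p > 0"
begin

definition prod_grp :: "(nat \<Rightarrow> nat \<Rightarrow> int) monoid" where
  "prod_grp = product_group S (\<lambda>p. product_group {..<r p} (\<lambda>_. integer_mod_group p))"

abbreviation P where "P \<equiv> carrier prod_grp"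

definition sub :: "(nat \<Rightarrow> nat \<Rightarrow> int) set \<Rightarrow> (nat \<Rightarrow> nat \<Rightarrow> int) monoid" where
  "sub A = prod_grp\<lparr>carrier := A\<rparr>"

text \<open>The canonical representative in the product of an arbitrary integer family; the
  restrictions supply the extensionality that \<open>P\<close> demands.\<close>

definition red :: "(nat \<Rightarrow> nat \<Rightarrow> int) \<Rightarrow> (nat \<Rightarrow> nat \<Rightarrow> int)" where
  "red u = (\<lambda>p\<in>S. \<lambda>j\<in>{..<r p}. u p j mod int p)"

definition null :: "(nat \<Rightarrow> nat \<Rightarrow> int) \<Rightarrow> bool" where
  "null u \<longleftrightarrow> (\<exists>N. \<forall>p\<in>S. N < p \<longrightarrow> (\<forall>j<r p. int p dvd u p j))"

text \<open>
  The subsets \<open>A\<close> with $\bigoplus \subseteq A \subseteq \prod$ such that $A / \bigoplus$ is a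
  $Q$-subspace of the torsion-free divisible group $\prod / \bigoplus$.
\<close>

definition isolated :: "(nat \<Rightarrow> nat \<Rightarrow> int) set \<Rightarrow> bool" where
  "isolated A \<longleftrightarrow> A \<subseteq> P \<and> red (\<lambda>_ _. 0) \<in> A \<and>
     (\<forall>y\<in>P. \<forall>a\<in>A. \<forall>b\<in>A. \<forall>n k l. n \<noteq> 0 \<longrightarrow>
        null (\<lambda>p j. n * y p j - (k * a p j + l * b p j)) \<longrightarrow> y \<in> A)"

lemma carrier_sub [simp]: "carrier (sub A) = A"
  by (simp add: sub_def)

lemma prime_int [simp]: "p \<in> S \<Longrightarrow> prime (int p)"
  using prime_S by simp

lemma pos_S [simp]: "p \<in> S \<Longrightarrow> 0 < p"
  using prime_S prime_gt_0_nat by blast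

lemma P_iff: "h \<in> P \<longleftrightarrow> h \<in> extensional S \<and>
    (\<forall>p\<in>S. h p \<in> extensional {..<r p} \<and> (\<forall>j<r p. 0 \<le> h p j \<and> h p j < int p))"
  by (auto simp: prod_grp_def PiE_iff carrier_integer_mod_group dest: pos_S)

lemma red_in_P [simp]: "red u \<in> P"
  by (auto simp: P_iff red_def)

lemma red_apply [simp]: "p \<in> S \<Longrightarrow> j < r p \<Longrightarrow> red u p j = u p j mod int p"
  by (simp add: red_def)

lemma P_eqI:
  assumes "h \<in> P" "h' \<in> P" "\<And>p j. p \<in> S \<Longrightarrow> j < r p \<Longrightarrow> int p dvd h p j - h' p j"
  shows "h = h'"
proof (rule extensionalityI[of _ S])
  show "h \<in> extensional S" "h' \<in> extensional S" using assms(1,2) by (auto simp: P_iff)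
  fix p assume p: "p \<in> S"
  show "h p = h' p"
  proof (rule extensionalityI[of _ "{..<r p}"])
    show "h p \<in> extensional {..<r p}" "h' p \<in> extensional {..<r p}"
      using assms(1,2) p by (auto simp: P_iff)
    show "h p j = h' p j" if "j \<in> {..<r p}" for j
      using that p assms(3) assms(1,2)[unfolded P_iff] by (intro eq_of_dvd_diff[of _ "int p"]) auto
  qed
qed

lemma mult_sub: "x \<otimes>\<^bsub>sub A\<^esub> y = red (\<lambda>p j. x p j + y p j)"
  by (simp add: sub_def prod_grp_def red_def)

lemma one_sub: "\<one>\<^bsub>sub A\<^esub> = red (\<lambda>_ _. 0)"
  by (simp add: sub_def prod_grp_def red_def)

lemma isolated_subset: "isolated A \<Longrightarrow> A \<subseteq> P"
  by (simp add: isolated_def)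

lemma isolated_zero: "isolated A \<Longrightarrow> red (\<lambda>_ _. 0) \<in> A"
  by (simp add: isolated_def)

lemma isolatedD:
  assumes "isolated A" "y \<in> P" "a \<in> A" "b \<in> A" "n \<noteq> 0"
    "null (\<lambda>p j. n * y p j - (k * a p j + l * b p j))"
  shows "y \<in> A"
  using assms unfolding isolated_def by blast

lemma isolated_divide:
  assumes "isolated A" "y \<in> P" "a \<in> A" "n \<noteq> 0" "null (\<lambda>p j. n * y p j - k * a p j)"
  shows "y \<in> A"
  using isolatedD[OF assms(1-3,3,4), of k 0] assms(5) by simp

lemma isolated_add:
  assumes "isolated A" "a \<in> A" "b \<in> A"
  shows "red (\<lambda>p j. k * a p j + l * b p j) \<in> A"
  by (rule isolatedD[OF assms(1) _ assms(2,3), of _ 1 k l])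
    (auto simp: null_def dvd_mod_diff_iff)

lemma isolated_sum:
  assumes "isolated A" "finite V" "\<And>i. i \<in> V \<Longrightarrow> e i \<in> A"
  shows "red (\<lambda>p j. \<Sum>i\<in>V. k i * e i p j) \<in> A"
  using assms(2,3)
proof (induction V)
  case empty
  then show ?case using isolated_zero[OF assms(1)] by simp
next
  case (insert i V)
  have "red (\<lambda>p j. k i * e i p j + 1 * red (\<lambda>p j. \<Sum>i\<in>V. k i * e i p j) p j) \<in> A"
    by (rule isolated_add[OF assms(1)]) (use insert in auto)
  also have "red (\<lambda>p j. k i * e i p j + 1 * red (\<lambda>p j. \<Sum>i\<in>V. k i * e i p j) p j) =
      red (\<lambda>p j. \<Sum>i\<in>insert i V. k i * e i p j)"
    using insert.hyps by (intro P_eqI) (auto simp: dvd_eq_mod_eq_0 mod_simps)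
  finally show ?case .
qed

lemma comm_group_sub:
  assumes "isolated A"
  shows "comm_group (sub A)"
proof (rule comm_groupI)
  have A: "A \<subseteq> P" using isolated_subset[OF assms] .
  show "x \<otimes>\<^bsub>sub A\<^esub> y \<in> carrier (sub A)" if "x \<in> carrier (sub A)" "y \<in> carrier (sub A)" for x y
    using isolated_add[OF assms, of x y 1 1] that by (simp add: mult_sub)
  show "\<one>\<^bsub>sub A\<^esub> \<in> carrier (sub A)" using isolated_zero[OF assms] by (simp add: one_sub)
  show "x \<otimes>\<^bsub>sub A\<^esub> y \<otimes>\<^bsub>sub A\<^esub> z = x \<otimes>\<^bsub>sub A\<^esub> (y \<otimes>\<^bsub>sub A\<^esub> z)" for x y z
    by (intro P_eqI) (auto simp: mult_sub dvd_eq_mod_eq_0 mod_simps)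
  show "x \<otimes>\<^bsub>sub A\<^esub> y = y \<otimes>\<^bsub>sub A\<^esub> x" for x y
    by (simp add: mult_sub add.commute)
  show "\<one>\<^bsub>sub A\<^esub> \<otimes>\<^bsub>sub A\<^esub> x = x" if "x \<in> carrier (sub A)" for x
    using that A by (intro P_eqI) (auto simp: mult_sub one_sub dvd_eq_mod_eq_0 mod_simps)
  show "\<exists>y\<in>carrier (sub A). y \<otimes>\<^bsub>sub A\<^esub> x = \<one>\<^bsub>sub A\<^esub>" if "x \<in> carrier (sub A)" for x
  proof (rule bexI)
    show "red (\<lambda>p j. (-1) * x p j + 0 * x p j) \<in> carrier (sub A)"
      using isolated_add[OF assms, of x x "-1" 0] that by simp
    show "red (\<lambda>p j. (-1) * x p j + 0 * x p j) \<otimes>\<^bsub>sub A\<^esub> x = \<one>\<^bsub>sub A\<^esub>"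
      by (intro P_eqI) (auto simp: mult_sub one_sub dvd_eq_mod_eq_0 mod_simps)
  qed
qed

lemma fo_structure_sub: "isolated A \<Longrightarrow> fo_structure (sub A)"
  using comm_group_sub by (intro fo_structure_group) (simp add: comm_group_def)

lemma pow_sub:
  assumes "p \<in> S" "j < r p"
  shows "int p dvd (x [^]\<^bsub>sub A\<^esub> (n::nat)) p j - int n * x p j"
proof (induction n)
  case 0
  then show ?case using assms by (simp add: one_sub)
next
  case (Suc n)
  then show ?case using assms by (simp add: mult_sub dvd_mod_diff_iff algebra_simps)
qed

lemma pow_sub_in_P: "x [^]\<^bsub>sub A\<^esub> (n::nat) \<in> P"
  by (cases n) (simp_all add: one_sub mult_sub)

text \<open>Multiplication by \<open>p\<close> kills the \<open>p\<close>-component. An element of a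
  divisible subgroup is a multiple of every \<open>p\<close> in \<open>S\<close>, so all its
  components vanish.\<close>

lemma reduced_group_sub:
  assumes "isolated A"
  shows "reduced_group (sub A)"
proof -
  have "H = {\<one>\<^bsub>sub A\<^esub>}" if H: "divisible_subgroup H (sub A)" for H
  proof -
    have sub: "subgroup H (sub A)" using H by (simp add: divisible_subgroup_def)
    have "x = \<one>\<^bsub>sub A\<^esub>" if "x \<in> H" for x
    proof (rule P_eqI)
      show "x \<in> P" using that subgroup.subset[OF sub] isolated_subset[OF assms] by auto
      fix p j assume pj: "p \<in> S" "j < r p"
      obtain y where y: "y [^]\<^bsub>sub A\<^esub> p = x"
        using H \<open>x \<in> H\<close> pj by (auto simp: divisible_subgroup_def dest!: pos_S)
      have "int p dvd x p j"
        using pow_sub[OF pj, where n = p and x = y and A = A, unfolded y] by (simp add: dvd_diff_left_iff)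
      then show "int p dvd x p j - \<one>\<^bsub>sub A\<^esub> p j" using pj by (simp add: one_sub)
    qed (simp add: one_sub)
    then show ?thesis using subgroup.one_closed[OF sub] by blast
  qed
  then show ?thesis using comm_group_sub[OF assms] by (auto simp: reduced_group_def)
qed

definition direct_sum where "direct_sum = {h \<in> P. null h}"

text \<open>Finite support amounts to vanishing beyond some bound, since a set of naturals is finite
  exactly when it is bounded.\<close>

lemma prime_sum_group_eq: "prime_sum_group S r = sub direct_sum"
proof -
  let ?G = "\<lambda>p. product_group {..<r p} (\<lambda>_. integer_mod_group p)"
  have nz: "h p \<noteq> \<one>\<^bsub>?G p\<^esub> \<longleftrightarrow> \<not> (\<forall>j<r p. int p dvd h p j)" if "h \<in> P" "p \<in> S" for h p
  proof -
    have "h p = \<one>\<^bsub>?G p\<^esub> \<longleftrightarrow> (\<forall>j<r p. h p j = 0)"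
      using that by (auto simp: P_iff fun_eq_iff extensional_def)
    moreover have "h p j = 0 \<longleftrightarrow> int p dvd h p j" if "j < r p" for j
      using that \<open>h \<in> P\<close> \<open>p \<in> S\<close> eq_of_dvd_diff[of "h p j" "int p" 0] by (auto simp: P_iff)
    ultimately show ?thesis by auto
  qed
  have "finite {p \<in> S. h p \<noteq> \<one>\<^bsub>?G p\<^esub>} \<longleftrightarrow> null h" if "h \<in> P" for h
  proof -
    have "{p \<in> S. h p \<noteq> \<one>\<^bsub>?G p\<^esub>} = {p \<in> S. \<not> (\<forall>j<r p. int p dvd h p j)}"
      using nz[OF that] by blast
    then show ?thesis
      unfolding null_def finite_nat_set_iff_bounded_le by (auto simp: not_less[symmetric])
  qed
  then have "carrier (sum_group S ?G) = direct_sum"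
    by (subst carrier_sum_group) (auto simp: direct_sum_def prod_grp_def)
  then show ?thesis
    by (simp add: prime_sum_group_def sum_group_def sub_def prod_grp_def subgroup_generated_def)
qed

text \<open>A nonzero \<open>n\<close> is invertible modulo every prime above its absolute value, so
  the product modulo the direct sum is torsion-free.\<close>

lemma null_cancel:
  assumes "n \<noteq> 0" "null (\<lambda>p j. n * u p j)"
  shows "null u"
proof -
  obtain N where N: "\<And>p j. p \<in> S \<Longrightarrow> N < p \<Longrightarrow> j < r p \<Longrightarrow> int p dvd n * u p j"
    using assms(2) by (auto simp: null_def)
  have "int p dvd u p j" if p: "p \<in> S" "max N (nat \<bar>n\<bar>) < p" and j: "j < r p" for p j
  proof -
    have "\<not> int p dvd n" using assms(1) p zdvd_imp_le[of "int p" "\<bar>n\<bar>"] by auto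
    then show ?thesis using N[of p j] p j prime_dvd_mult_iff[OF prime_int[OF p(1)]] by auto
  qed
  then show ?thesis unfolding null_def by blast
qed

text \<open>Beyond the larger of the two thresholds both divisibilities are available. An argument
  from one family supplies it twice.\<close>

lemma null_combine:
  assumes "null u" "null v"
    "\<And>p j. p \<in> S \<Longrightarrow> j < r p \<Longrightarrow> int p dvd u p j \<Longrightarrow> int p dvd v p j \<Longrightarrow> int p dvd w p j"
  shows "null w"
proof -
  obtain K L where "\<And>p j. p \<in> S \<Longrightarrow> K < p \<Longrightarrow> j < r p \<Longrightarrow> int p dvd u p j"
    "\<And>p j. p \<in> S \<Longrightarrow> L < p \<Longrightarrow> j < r p \<Longrightarrow> int p dvd v p j"
    using assms(1,2) unfolding null_def by metis
  then have "\<forall>p\<in>S. max K L < p \<longrightarrow> (\<forall>j<r p. int p dvd w p j)" using assms(3) by auto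
  then show ?thesis unfolding null_def by blast
qed

text \<open>This is the zero subspace, which is isolated by torsion-freeness.\<close>

lemma isolated_direct_sum: "isolated direct_sum"
  unfolding isolated_def
proof (intro conjI ballI allI impI)
  show "direct_sum \<subseteq> P" "red (\<lambda>_ _. 0) \<in> direct_sum" by (auto simp: direct_sum_def null_def)
  fix y a b and n k l :: int
  assume y: "y \<in> P" and ab: "a \<in> direct_sum" "b \<in> direct_sum" and n: "n \<noteq> 0"
    and eq: "null (\<lambda>p j. n * y p j - (k * a p j + l * b p j))"
  have "null (\<lambda>p j. k * a p j + l * b p j)"
    by (rule null_combine[of a b]) (use ab in \<open>auto simp: direct_sum_def\<close>)
  with eq have "null (\<lambda>p j. n * y p j)"
    by (rule null_combine) (simp add: dvd_diff_left_iff)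
  then show "y \<in> direct_sum" using y null_cancel[OF n] by (simp add: direct_sum_def)
qed

section \<open>The back-and-forth argument\<close>

definition rel :: "nat \<Rightarrow> nat set \<Rightarrow> (nat \<Rightarrow> int) \<Rightarrow> (nat \<Rightarrow> nat \<Rightarrow> nat \<Rightarrow> int) \<Rightarrow> bool" where
  "rel N V k e \<longleftrightarrow> (\<forall>p\<in>S. N < p \<longrightarrow> (\<forall>j<r p. int p dvd (\<Sum>i\<in>V. k i * e i p j)))"

text \<open>The finite information that a formula can see. One bound \<open>N\<close> limits both
  primes and coefficients, so that every nonzero coefficient is a unit at the primes where relations
  are tested.\<close>

definition sim :: "nat \<Rightarrow> nat set \<Rightarrow> (nat \<Rightarrow> nat \<Rightarrow> nat \<Rightarrow> int) \<Rightarrow> (nat \<Rightarrow> nat \<Rightarrow> nat \<Rightarrow> int) \<Rightarrow> bool" where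
  "sim N V e e' \<longleftrightarrow> (\<forall>i\<in>V. \<forall>p\<in>S. p \<le> N \<longrightarrow> (\<forall>j<r p. e i p j = e' i p j)) \<and>
     (\<forall>k. (\<forall>i\<in>V. \<bar>k i\<bar> \<le> int N) \<longrightarrow> (rel N V k e \<longleftrightarrow> rel N V k e'))"

lemma sim_refl: "sim N V e e"
  by (simp add: sim_def)

lemma sim_sym: "sim N V e e' \<Longrightarrow> sim N V e' e"
  by (auto simp: sim_def)

text \<open>Lowering the threshold adds only conditions at primes above \<open>N\<close> and up to
  \<open>N'\<close>, where \<open>e\<close> and \<open>e'\<close> agree exactly.\<close>

lemma sim_rel:
  assumes "sim N' V e e'" "N \<le> N'" "\<And>i. i \<in> V \<Longrightarrow> \<bar>k i\<bar> \<le> int N'"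
  shows "rel N V k e \<longleftrightarrow> rel N V k e'"
proof -
  have *: "rel N V k f \<longleftrightarrow> rel N' V k f \<and>
      (\<forall>p\<in>S. N < p \<and> p \<le> N' \<longrightarrow> (\<forall>j<r p. int p dvd (\<Sum>i\<in>V. k i * f i p j)))" for f
    unfolding rel_def using assms(2) by (meson linorder_not_le order_le_less_trans)
  have "(\<Sum>i\<in>V. k i * e i p j) = (\<Sum>i\<in>V. k i * e' i p j)" if "p \<in> S" "p \<le> N'" "j < r p" for p j
    using assms(1) that by (intro sum.cong) (auto simp: sim_def)
  moreover have "rel N' V k e \<longleftrightarrow> rel N' V k e'" using assms(1,3) by (simp add: sim_def)
  ultimately show ?thesis unfolding * by auto
qed

text \<open>A relation over \<open>V\<close> becomes one over \<open>V'\<close> by giving the new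
  variables coefficient zero.\<close>

lemma sim_mono:
  assumes "sim N' V' e e'" "N \<le> N'" "V \<subseteq> V'" "finite V'"
  shows "sim N V e e'"
proof -
  have "rel N V k e \<longleftrightarrow> rel N V k e'" if "\<forall>i\<in>V. \<bar>k i\<bar> \<le> int N" for k
  proof -
    let ?k = "\<lambda>i. if i \<in> V then k i else 0"
    have "(\<Sum>i\<in>V'. ?k i * f i p j) = (\<Sum>i\<in>V. k i * f i p j)" for f :: "nat \<Rightarrow> nat \<Rightarrow> nat \<Rightarrow> int" and p j
      using assms(3,4) by (intro sum.mono_neutral_cong_right) auto
    then have "rel N V k f \<longleftrightarrow> rel N V' ?k f" for f by (simp add: rel_def)
    moreover have "rel N V' ?k e \<longleftrightarrow> rel N V' ?k e'"
      by (rule sim_rel[OF assms(1,2)]) (use that assms(2) in force)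
    ultimately show ?thesis by simp
  qed
  then show ?thesis using assms(1-3) by (fastforce simp: sim_def)
qed

lemma not_dvd_small: "p \<in> S \<Longrightarrow> N < p \<Longrightarrow> a \<noteq> 0 \<Longrightarrow> \<bar>a\<bar> \<le> int N \<Longrightarrow> \<not> int p dvd a"
  using zdvd_imp_le[of "int p" "\<bar>a\<bar>"] by auto

text \<open>
  Eliminating \<open>x\<close> between two relations with coefficients at most \<open>N\<close> gives a relation with
  coefficients at most \<open>2 * N * N\<close>. Nonzero integers up to \<open>N\<close> are invertible modulo the primes
  above \<open>N\<close>, so a relation involving \<open>x\<close> determines it there.
\<close>

lemma sim_extend:
  assumes B: "isolated B" and c: "c \<in> P" and V: "finite V" "x \<notin> V"
    and e': "\<And>i. i \<in> V \<Longrightarrow> e' i \<in> B" and sim: "sim (2 * N * N + N) V e e'"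
  shows "\<exists>d\<in>B. sim N (insert x V) (e(x := c)) (e'(x := d))"
proof -
  let ?L = "\<lambda>f k p j. \<Sum>i\<in>V. k i * (f i :: nat \<Rightarrow> nat \<Rightarrow> int) p j"
  have rel_insert: "rel N (insert x V) k (f(x := y)) \<longleftrightarrow>
      (\<forall>p\<in>S. N < p \<longrightarrow> (\<forall>j<r p. int p dvd k x * y p j + ?L f k p j))" for k f y
  proof -
    have "(\<Sum>i\<in>insert x V. k i * (f(x := y)) i p j) = k x * y p j + ?L f k p j" for p j
      using V by (auto intro!: sum.cong)
    then show ?thesis by (simp add: rel_def)
  qed
  have simI: "sim N (insert x V) (e(x := c)) (e'(x := d))"
    if "\<And>p j. p \<in> S \<Longrightarrow> p \<le> N \<Longrightarrow> j < r p \<Longrightarrow> d p j = c p j"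
      and "\<And>k. \<forall>i\<in>insert x V. \<bar>k i\<bar> \<le> int N \<Longrightarrow>
        rel N (insert x V) k (e(x := c)) \<longleftrightarrow> rel N (insert x V) k (e'(x := d))" for d
    using that sim V(2) by (auto simp: sim_def)
  show ?thesis
  \<comment> \<open>Either a bounded relation with nonzero coefficient at \<open>x\<close> ties
    \<open>c\<close> to the other elements, and \<open>d\<close> is built to satisfy the same one,
    or \<open>c\<close> is generic and \<open>d\<close> must avoid all such relations.\<close>
  proof (cases "\<exists>k. (\<forall>i\<in>insert x V. \<bar>k i\<bar> \<le> int N) \<and> k x \<noteq> 0 \<and> rel N (insert x V) k (e(x := c))")
    case True
    then obtain k0 where k0: "\<And>i. i \<in> insert x V \<Longrightarrow> \<bar>k0 i\<bar> \<le> int N" "k0 x \<noteq> 0"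
      and rel0: "rel N (insert x V) k0 (e(x := c))" by blast
    have unit: "\<not> int p dvd k0 x" if "p \<in> S" "N < p" for p
      using not_dvd_small[OF that k0(2)] k0(1) by simp
    have "\<exists>y. p \<in> S \<longrightarrow> N < p \<longrightarrow> int p dvd k0 x * y + ?L e' k0 p j" for p j
      using dvd_solve[OF prime_int unit] by blast
    then obtain y where y: "\<And>p j. p \<in> S \<Longrightarrow> N < p \<Longrightarrow> int p dvd k0 x * y p j + ?L e' k0 p j"
      by metis
    \<comment> \<open>Components up to \<open>N\<close> copy \<open>c\<close>; beyond
      \<open>N\<close> they solve the relation \<open>k0\<close> over \<open>e'\<close>.\<close>
    define d where "d = red (\<lambda>p j. if p \<le> N then c p j else y p j)"
    have d: "int p dvd k0 x * d p j + ?L e' k0 p j" if "p \<in> S" "N < p" "j < r p" for p j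
      using y[OF that(1,2)] that by (simp add: d_def dvd_mod_diff_iff)
    \<comment> \<open>Up to finitely many primes, \<open>k0 x * d\<close> is an integer combination
      of the \<open>e' i\<close>, so isolation puts \<open>d\<close> in \<open>B\<close>.\<close>
    have "d \<in> B"
    proof (rule isolated_divide[OF B])
      show "red (?L e' k0) \<in> B" using isolated_sum[OF B V(1) e'] .
      show "null (\<lambda>p j. k0 x * d p j - (- 1) * red (?L e' k0) p j)"
        unfolding null_def using d by (intro exI[of _ N]) (auto simp: dvd_eq_mod_eq_0 mod_simps)
    qed (use k0 in \<open>auto simp: d_def\<close>)
    \<comment> \<open>Multiplying \<open>k\<close> by the unit \<open>k0 x\<close> and subtracting
      \<open>k x\<close> times the valid relation \<open>k0\<close> eliminates the value at
      \<open>x\<close>.\<close>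
    have elim: "rel N (insert x V) k (f(x := z)) \<longleftrightarrow> rel N V (\<lambda>i. k0 x * k i - k x * k0 i) f"
      if "rel N (insert x V) k0 (f(x := z))" for k f z
    proof -
      have "int p dvd k x * z p j + ?L f k p j \<longleftrightarrow>
          int p dvd (\<Sum>i\<in>V. (k0 x * k i - k x * k0 i) * f i p j)"
        if p: "p \<in> S" "N < p" "j < r p" for p j
      proof -
        have z: "int p dvd k x * (k0 x * z p j + ?L f k0 p j)"
          using \<open>rel N (insert x V) k0 (f(x := z))\<close> p by (auto simp: rel_insert)
        have "(\<Sum>i\<in>V. (k0 x * k i - k x * k0 i) * f i p j) = k0 x * ?L f k p j - k x * ?L f k0 p j"
          by (simp add: sum_distrib_left sum_subtractf algebra_simps)
        also have "\<dots> = k0 x * (k x * z p j + ?L f k p j) - k x * (k0 x * z p j + ?L f k0 p j)"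
          by (simp add: algebra_simps)
        finally show ?thesis
          using z unit[OF p(1,2)] prime_dvd_mult_iff[OF prime_int[OF p(1)]]
          by (simp add: dvd_diff_left_iff)
      qed
      then show ?thesis by (simp add: rel_insert) (simp add: rel_def)
    qed
    have rel0': "rel N (insert x V) k0 (e'(x := d))" using d by (simp add: rel_insert)
    have "sim N (insert x V) (e(x := c)) (e'(x := d))"
    proof (rule simI)
      show "d p j = c p j" if "p \<in> S" "p \<le> N" "j < r p" for p j
        using that c by (auto simp: d_def P_iff)
      fix k assume k: "\<forall>i\<in>insert x V. \<bar>k i\<bar> \<le> int N"
      have "\<bar>k0 x * k i - k x * k0 i\<bar> \<le> int (2 * N * N + N)" if "i \<in> V" for i
      proof -
        have "\<bar>k0 x * k i\<bar> \<le> int N * int N" "\<bar>k x * k0 i\<bar> \<le> int N * int N"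
          unfolding abs_mult using k k0(1) that by (auto intro!: mult_mono)
        then show ?thesis by simp
      qed
      then have "rel N V (\<lambda>i. k0 x * k i - k x * k0 i) e \<longleftrightarrow> rel N V (\<lambda>i. k0 x * k i - k x * k0 i) e'"
        by (intro sim_rel[OF sim]) auto
      then show "rel N (insert x V) k (e(x := c)) \<longleftrightarrow> rel N (insert x V) k (e'(x := d))"
        by (simp add: elim[OF rel0] elim[OF rel0'])
    qed
    then show ?thesis using \<open>d \<in> B\<close> by blast
  next
    case False
    \<comment> \<open>Each candidate has finite support and hence lies in every isolated
      \<open>B\<close>. For \<open>q > N\<close> the entry 1 at \<open>q\<close> separates it from
      the other candidates.\<close>
    define cand where "cand q = red (\<lambda>p j. if p \<le> N then c p j else if p = q then 1 else 0)" for q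
    have cand_B: "cand q \<in> B" for q
      by (rule isolated_divide[OF B _ isolated_zero[OF B], of _ 1 0])
        (auto simp: cand_def null_def intro!: exI[of _ "N + q"])
    let ?K = "insert x V \<rightarrow>\<^sub>E {- int N..int N}"
    let ?Q = "{q \<in> S. N < q}"
    have "infinite ?Q"
    proof
      assume "finite ?Q"
      then have "finite (?Q \<union> {..N})" by simp
      moreover have "S \<subseteq> ?Q \<union> {..N}" by auto
      ultimately show False using infinite_S finite_subset by blast
    qed
    txt \<open>Two distinct candidates cannot satisfy the same relation with nonzero coefficient at \<open>x\<close>,
      and there are only finitely many relations to avoid.\<close>
    have "\<exists>q\<in>?Q. \<forall>k\<in>?K. k x \<noteq> 0 \<longrightarrow> \<not> rel N (insert x V) k (e'(x := cand q))"
    proof (rule ccontr)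
      assume "\<not> ?thesis"
      then obtain K where K: "\<And>q. q \<in> ?Q \<Longrightarrow> K q \<in> ?K \<and> K q x \<noteq> 0 \<and> rel N (insert x V) (K q) (e'(x := cand q))"
        by metis
      have "finite ?K" using V(1) by (intro finite_PiE) auto
      moreover have "K ` ?Q \<subseteq> ?K" using K by blast
      ultimately have "\<not> inj_on K ?Q" using \<open>infinite ?Q\<close> finite_imageD finite_subset by blast
      then obtain q q' where q: "q \<in> ?Q" "q' \<in> ?Q" "q \<noteq> q'" "K q = K q'" by (auto simp: inj_on_def)
      have j: "0 < r q" using r_pos q(1) by simp
      have prime: "prime q" "q > 1" using q(1) prime_S prime_gt_1_nat by auto
      \<comment> \<open>Both relations are evaluated at the prime \<open>q\<close> in component 0,
        which exists as \<open>r q > 0\<close>; subtracting them leaves the coefficient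
        \<open>K q x\<close>.\<close>
      have "int q dvd K q x * cand q q 0 + ?L e' (K q) q 0"
        "int q dvd K q x * cand q' q 0 + ?L e' (K q) q 0"
        using K[OF q(1)] K[OF q(2)] q j unfolding rel_insert by auto
      moreover have "cand q q 0 = 1" "cand q' q 0 = 0"
        using q j prime by (auto simp: cand_def)
      ultimately have "int q dvd K q x"
        by (metis add_cancel_left_left dvd_add_left_iff mult.right_neutral mult_zero_right)
      moreover have "\<bar>K q x\<bar> \<le> int N" using K[OF q(1)] by (auto simp: PiE_iff abs_le_iff)
      ultimately show False using not_dvd_small[of q N "K q x"] q(1) K[OF q(1)] by blast
    qed
    then obtain q where q: "q \<in> ?Q"
      and free: "\<And>k. k \<in> ?K \<Longrightarrow> k x \<noteq> 0 \<Longrightarrow> \<not> rel N (insert x V) k (e'(x := cand q))" by blast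
    have "sim N (insert x V) (e(x := c)) (e'(x := cand q))"
    proof (rule simI)
      show "cand q p j = c p j" if "p \<in> S" "p \<le> N" "j < r p" for p j
        using that c by (auto simp: cand_def P_iff)
      fix k assume k: "\<forall>i\<in>insert x V. \<bar>k i\<bar> \<le> int N"
      show "rel N (insert x V) k (e(x := c)) \<longleftrightarrow> rel N (insert x V) k (e'(x := cand q))"
      proof (cases "k x = 0")
        case True
        then have "rel N (insert x V) k (f(x := z)) \<longleftrightarrow> rel N V k f" for f z
          by (simp add: rel_insert) (simp add: rel_def)
        moreover have "rel N V k e \<longleftrightarrow> rel N V k e'"
        proof (rule sim_rel[OF sim])
          show "\<bar>k i\<bar> \<le> int (2 * N * N + N)" if "i \<in> V" for i
          proof -
            have "\<bar>k i\<bar> \<le> int N" using k that by simp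
            also have "\<dots> \<le> int (2 * N * N + N)" by (simp only: of_nat_le_iff)
            finally show ?thesis .
          qed
        qed simp
        ultimately show ?thesis by simp
      next
        case kx: False
        \<comment> \<open>The relation fails on both sides: for \<open>c\<close> by the case
          assumption, for \<open>cand q\<close> by its choice. Restricting \<open>k\<close> places
          it in the finite set \<open>?K\<close> without changing the sums.\<close>
        have "restrict k (insert x V) \<in> ?K" using k by (auto simp: abs_le_iff)
        moreover have "rel N (insert x V) (restrict k (insert x V)) f \<longleftrightarrow> rel N (insert x V) k f" for f
          unfolding rel_def by (intro ball_cong imp_cong all_cong arg_cong2[of _ _ _ _ "(dvd)"] refl sum.cong) auto
        ultimately have "\<not> rel N (insert x V) k (e'(x := cand q))"
          using free[of "restrict k (insert x V)"] kx by simp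
        then show ?thesis using False k kx by blast
      qed
    qed
    then show ?thesis using cand_B by blast
  qed
qed

section \<open>Truth of formulas under similarity of valuations\<close>

lemma tm_val_sub_in_P: "range e \<subseteq> P \<Longrightarrow> tm_val (sub A) e t \<in> P"
  by (cases t) (auto simp: mult_sub)

text \<open>Any finite \<open>V\<close> containing the variables is allowed, so that both sides of
  an equation expand over one index set.\<close>

lemma tm_val_sub:
  assumes "p \<in> S" "j < r p" "finite V" "tm_vars t \<subseteq> V"
  shows "int p dvd tm_val (sub A) e t p j - (\<Sum>i\<in>V. occurrences t i * e i p j)"
  using assms(4)
proof (induction t)
  case (Var x)
  then have "(\<Sum>i\<in>V. occurrences (Var x) i * e i p j) = (\<Sum>i\<in>V. if i = x then e i p j else 0)"
    by (intro sum.cong) auto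
  also have "\<dots> = e x p j" using Var assms(3) by simp
  finally show ?case by simp
next
  case (Plus s t)
  then have "int p dvd (tm_val (sub A) e s p j - (\<Sum>i\<in>V. occurrences s i * e i p j)) +
      (tm_val (sub A) e t p j - (\<Sum>i\<in>V. occurrences t i * e i p j))"
    by (intro dvd_add) auto
  then show ?case
    using assms(1,2) by (simp add: mult_sub dvd_mod_diff_iff sum.distrib algebra_simps)
qed

lemma sat_Eq_sub:
  assumes "range e \<subseteq> P"
  shows "sat (sub A) e (Eq s t) \<longleftrightarrow> (\<forall>p\<in>S. \<forall>j<r p.
    int p dvd (\<Sum>i\<in>tm_vars s \<union> tm_vars t. (occurrences s i - occurrences t i) * e i p j))"
proof -
  let ?V = "tm_vars s \<union> tm_vars t"
  have "int p dvd tm_val (sub A) e s p j - tm_val (sub A) e t p j \<longleftrightarrow>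
      int p dvd (\<Sum>i\<in>?V. (occurrences s i - occurrences t i) * e i p j)"
    if "p \<in> S" "j < r p" for p j
  proof -
    have "int p dvd (tm_val (sub A) e s p j - (\<Sum>i\<in>?V. occurrences s i * e i p j)) -
      (tm_val (sub A) e t p j - (\<Sum>i\<in>?V. occurrences t i * e i p j))"
      using that by (intro dvd_diff tm_val_sub) auto
    also have "\<dots> = (tm_val (sub A) e s p j - tm_val (sub A) e t p j) -
        (\<Sum>i\<in>?V. (occurrences s i - occurrences t i) * e i p j)"
      by (simp add: left_diff_distrib sum_subtractf)
    finally show ?thesis by (rule dvd_iff_of_dvd_diff)
  qed
  moreover have "tm_val (sub A) e s = tm_val (sub A) e t \<longleftrightarrow>
      (\<forall>p\<in>S. \<forall>j<r p. int p dvd tm_val (sub A) e s p j - tm_val (sub A) e t p j)"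
    using P_eqI[OF tm_val_sub_in_P[OF assms] tm_val_sub_in_P[OF assms]] by auto
  ultimately show ?thesis by simp
qed

text \<open>The bound depends on the formula alone. A quantifier turns \<open>N\<close> into
  \<open>2 * N * N + N\<close>, with \<open>sim_extend\<close> supplying the answering witness; the
  converse direction exchanges \<open>A\<close> and \<open>B\<close>.\<close>

lemma sim_sat:
  "\<exists>N. \<forall>A B e e'. isolated A \<longrightarrow> isolated B \<longrightarrow> range e \<subseteq> A \<longrightarrow> range e' \<subseteq> B \<longrightarrow>
     sim N (free_vars \<phi>) e e' \<longrightarrow> (sat (sub A) e \<phi> \<longleftrightarrow> sat (sub B) e' \<phi>)"
proof (induction \<phi>)
  case (Eq s t)
  let ?V = "tm_vars s \<union> tm_vars t" and ?k = "\<lambda>i. occurrences s i - occurrences t i"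
  obtain K L where KL: "\<And>i. \<bar>occurrences s i\<bar> \<le> int K" "\<And>i. \<bar>occurrences t i\<bar> \<le> int L"
    using occurrences_bounded by meson
  have k: "\<bar>?k i\<bar> \<le> int (K + L)" for i using KL[of i] by simp
  have "sat (sub A) e (Eq s t) \<longleftrightarrow> sat (sub B) e' (Eq s t)"
    if AB: "isolated A" "isolated B" and ran: "range e \<subseteq> A" "range e' \<subseteq> B"
      and sim: "sim (K + L) ?V e e'" for A B e e'
  proof -
    have P: "range e \<subseteq> P" "range e' \<subseteq> P" using AB ran isolated_subset by blast+
    \<comment> \<open>At primes up to \<open>K + L\<close> the sums agree exactly; beyond, the
      equation is one of the relations that \<open>sim\<close> compares.\<close>
    have split: "(\<forall>p\<in>S. \<forall>j<r p. int p dvd (\<Sum>i\<in>?V. ?k i * f i p j)) \<longleftrightarrow> rel (K + L) ?V ?k f \<and>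
        (\<forall>p\<in>S. p \<le> K + L \<longrightarrow> (\<forall>j<r p. int p dvd (\<Sum>i\<in>?V. ?k i * f i p j)))" for f
      unfolding rel_def by (meson linorder_not_le)
    have "(\<Sum>i\<in>?V. ?k i * e i p j) = (\<Sum>i\<in>?V. ?k i * e' i p j)"
      if "p \<in> S" "p \<le> K + L" "j < r p" for p j
      using sim that by (intro sum.cong) (auto simp: sim_def)
    moreover have "rel (K + L) ?V ?k e \<longleftrightarrow> rel (K + L) ?V ?k e'"
      using sim k by (auto simp: sim_def)
    ultimately show ?thesis unfolding sat_Eq_sub[OF P(1)] sat_Eq_sub[OF P(2)] split by auto
  qed
  then show ?case by (intro exI[of _ "K + L"]) simp
next
  case (Neg \<phi>)
  then show ?case by simp
next
  case (Conj \<phi> \<psi>)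
  then obtain K L where
    K: "\<And>A B e e'. \<lbrakk>isolated A; isolated B; range e \<subseteq> A; range e' \<subseteq> B; sim K (free_vars \<phi>) e e'\<rbrakk>
      \<Longrightarrow> sat (sub A) e \<phi> \<longleftrightarrow> sat (sub B) e' \<phi>" and
    L: "\<And>A B e e'. \<lbrakk>isolated A; isolated B; range e \<subseteq> A; range e' \<subseteq> B; sim L (free_vars \<psi>) e e'\<rbrakk>
      \<Longrightarrow> sat (sub A) e \<psi> \<longleftrightarrow> sat (sub B) e' \<psi>"
    by metis
  have "sim K (free_vars \<phi>) e e'" "sim L (free_vars \<psi>) e e'"
    if "sim (max K L) (free_vars (Conj \<phi> \<psi>)) e e'" for e e'
    by (rule sim_mono[OF that]; simp)+
  then have "sat (sub A) e (Conj \<phi> \<psi>) \<longleftrightarrow> sat (sub B) e' (Conj \<phi> \<psi>)"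
    if "isolated A" "isolated B" "range e \<subseteq> A" "range e' \<subseteq> B"
      "sim (max K L) (free_vars (Conj \<phi> \<psi>)) e e'" for A B e e'
    using K[of A B e e'] L[of A B e e'] that by simp
  then show ?case by blast
next
  case (Exi x \<phi>)
  then obtain N where
    N: "\<And>A B e e'. \<lbrakk>isolated A; isolated B; range e \<subseteq> A; range e' \<subseteq> B; sim N (free_vars \<phi>) e e'\<rbrakk>
      \<Longrightarrow> sat (sub A) e \<phi> \<longleftrightarrow> sat (sub B) e' \<phi>"
    by metis
  let ?N = "2 * N * N + N" and ?V = "free_vars \<phi> - {x}"
  have forth: "\<exists>d\<in>B. sat (sub B) (e'(x := d)) \<phi>"
    if AB: "isolated A" "isolated B" and ran: "range e \<subseteq> A" "range e' \<subseteq> B" and sim: "sim ?N ?V e e'"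
      and c: "c \<in> A" "sat (sub A) (e(x := c)) \<phi>" for A B e e' c
  proof -
    have "c \<in> P" using AB c isolated_subset by blast
    then obtain d where d: "d \<in> B" "sim N (insert x ?V) (e(x := c)) (e'(x := d))"
      using sim_extend[OF AB(2) _ _ _ range_subsetD[OF ran(2)] sim, of c x] by auto
    have "sat (sub A) (e(x := c)) \<phi> \<longleftrightarrow> sat (sub B) (e'(x := d)) \<phi>"
    proof (rule N[OF AB])
      show "range (e(x := c)) \<subseteq> A" "range (e'(x := d)) \<subseteq> B" using ran c d by auto
      show "sim N (free_vars \<phi>) (e(x := c)) (e'(x := d))" by (rule sim_mono[OF d(2)]) auto
    qed
    then show ?thesis using c d by blast
  qed
  have "sat (sub A) e (Exi x \<phi>) \<longleftrightarrow> sat (sub B) e' (Exi x \<phi>)"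
    if AB: "isolated A" "isolated B" and ran: "range e \<subseteq> A" "range e' \<subseteq> B"
      and sim: "sim ?N (free_vars (Exi x \<phi>)) e e'" for A B e e'
    using forth[OF AB ran] forth[OF AB(2,1) ran(2,1)] sim sim_sym[OF sim]
    unfolding sat.simps free_vars.simps carrier_sub by blast
  then show ?case by blast
qed

text \<open>A valuation in \<open>A\<close>, read also in \<open>B\<close>, is similar to itself at
  every bound.\<close>

lemma isolated_elementary:
  assumes "isolated A" "isolated B" "A \<subseteq> B"
  shows "elementary_embedding (sub A) (sub B) id"
proof -
  have "sat (sub A) e \<phi> \<longleftrightarrow> sat (sub B) (id \<circ> e) \<phi>" if "range e \<subseteq> A" for e \<phi>
  proof -
    have "range e \<subseteq> B" using that assms(3) by blast
    then show ?thesis using sim_sat[of \<phi>] sim_refl assms(1,2) that unfolding id_comp by blast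
  qed
  then show ?thesis using assms(3) by (auto simp: elementary_embedding_def)
qed

section \<open>Subgroups given by spaces of polynomials\<close>

text \<open>For \<open>I\<close> closed under integer combinations, this is the preimage in
  \<open>P\<close> of the rational span of the values of \<open>I\<close> at the logarithm sequence;
  \<open>n\<close> is a common denominator.\<close>

definition poly_span :: "int poly set \<Rightarrow> (nat \<Rightarrow> nat \<Rightarrow> int) set" where
  "poly_span I = {h \<in> P. \<exists>f\<in>I. \<exists>n. n \<noteq> 0 \<and> null (\<lambda>p j. n * h p j - poly f (int (floor_log p)))}"

lemma poly_spanI:
  assumes "h \<in> P" "f \<in> I" "n \<noteq> 0" "null (\<lambda>p j. n * h p j - poly f (int (floor_log p)))"
  shows "h \<in> poly_span I"
  using assms by (auto simp: poly_span_def)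

lemma poly_span_mono: "I \<subseteq> J \<Longrightarrow> poly_span I \<subseteq> poly_span J"
  by (auto simp: poly_span_def)

lemma isolated_poly_span:
  assumes "0 \<in> I" "\<And>f g k l. f \<in> I \<Longrightarrow> g \<in> I \<Longrightarrow> smult k f + smult l g \<in> I"
  shows "isolated (poly_span I)"
  unfolding isolated_def
proof (intro conjI ballI allI impI)
  show "poly_span I \<subseteq> P" by (auto simp: poly_span_def)
  show "red (\<lambda>_ _. 0) \<in> poly_span I"
    by (rule poly_spanI[OF _ assms(1), of _ 1]) (auto simp: null_def)
  fix y a b and n k l :: int
  assume y: "y \<in> P" and a: "a \<in> poly_span I" and b: "b \<in> poly_span I" and n: "n \<noteq> 0"
    and eq: "null (\<lambda>p j. n * y p j - (k * a p j + l * b p j))"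
  let ?x = "\<lambda>p. int (floor_log p)"
  obtain f s where f: "f \<in> I" "s \<noteq> 0" "null (\<lambda>p j. s * a p j - poly f (?x p))"
    using a by (auto simp: poly_span_def)
  obtain g t where g: "g \<in> I" "t \<noteq> 0" "null (\<lambda>p j. t * b p j - poly g (?x p))"
    using b by (auto simp: poly_span_def)
  \<comment> \<open>Modulo the direct sum, multiplying \<open>n * y = k * a + l * b\<close> by
    \<open>s * t\<close> and inserting \<open>s * a = f\<close> and \<open>t * b = g\<close> gives
    this numerator over the denominator \<open>s * t * n\<close>.\<close>
  let ?h = "smult (k * t) f + smult (l * s) g"
  have "null (\<lambda>p j. k * t * (s * a p j - poly f (?x p)) + l * s * (t * b p j - poly g (?x p)))"
    by (rule null_combine[OF f(3) g(3)]) auto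
  then have "null (\<lambda>p j. (s * t * n) * y p j - poly ?h (?x p))"
  proof (rule null_combine[OF eq])
    fix p j
    let ?u = "n * y p j - (k * a p j + l * b p j)"
      and ?v = "k * t * (s * a p j - poly f (?x p)) + l * s * (t * b p j - poly g (?x p))"
    assume "int p dvd ?u" "int p dvd ?v"
    then have "int p dvd s * t * ?u + ?v" by simp
    also have "s * t * ?u + ?v = (s * t * n) * y p j - poly ?h (?x p)" by (simp add: algebra_simps)
    finally show "int p dvd (s * t * n) * y p j - poly ?h (?x p)" .
  qed
  then show "y \<in> poly_span I"
    using y f g n assms(2) by (intro poly_spanI[of y ?h I "s * t * n"]) auto
qed

text \<open>The logarithm lies strictly between 0 and \<open>p\<close>. Multiplication by it is thus
  invertible in every component, without exceptional primes.\<close>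

lemma not_dvd_floor_log:
  assumes "p \<in> S"
  shows "\<not> int p dvd int (floor_log p)"
proof -
  have "2 \<le> p" using prime_S[OF assms] by (rule prime_ge_2_nat)
  then have "0 < floor_log p" by (subst floor_log_rec) simp_all
  moreover have "floor_log p < 2 ^ floor_log p" by (rule less_exp)
  moreover have "2 ^ floor_log p \<le> p" using \<open>2 \<le> p\<close> by (simp add: floor_log_exp2_le)
  ultimately have "floor_log p < p" by linarith
  then show ?thesis using \<open>0 < floor_log p\<close> by (simp add: nat_dvd_not_less)
qed

text \<open>
  The element \<open>a h - a\<^sub>p h\<close> has zero \<open>p\<close>-component, hence is divisible by \<open>p\<close>, and so is its image.
\<close>

lemma hom_scale:
  fixes a :: "nat \<Rightarrow> nat"
  assumes A: "isolated A" and B: "isolated B" and \<phi>: "\<phi> \<in> hom (sub A) (sub B)"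
    and h: "h \<in> A" and g: "red (\<lambda>p j. int (a p) * h p j) \<in> A" (is "?g \<in> A")
  shows "\<phi> ?g = red (\<lambda>p j. int (a p) * \<phi> h p j)"
proof (rule P_eqI)
  have \<phi>_B: "\<phi> x \<in> B" if "x \<in> A" for x using \<phi> that by (auto simp: hom_def)
  show "\<phi> ?g \<in> P" using \<phi>_B[OF g] isolated_subset[OF B] by auto
  interpret A: comm_group "sub A" using comm_group_sub[OF A] .
  interpret B: comm_group "sub B" using comm_group_sub[OF B] .
  interpret \<phi>: group_hom "sub A" "sub B" \<phi> using \<phi> by unfold_locales
  fix p j assume pj: "p \<in> S" "j < r p"
  \<comment> \<open>For the fixed prime \<open>p\<close> the factor \<open>a p\<close> is a single
    integer, so \<open>a p * h\<close> is an ordinary multiple, which \<open>\<phi>\<close>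
    preserves.\<close>
  define y where "y = red (\<lambda>q i. 1 * ?g q i + (- int (a p)) * h q i)"
  have y: "y \<in> A" unfolding y_def by (rule isolated_add[OF A g h])
  have y_p: "int p dvd y p i" if "i < r p" for i
    using pj that by (simp add: y_def dvd_mod_diff_iff)
  \<comment> \<open>At \<open>p\<close> the value 0 works since \<open>y\<close> vanishes there; at
    any other prime of \<open>S\<close> the number \<open>p\<close> is invertible.\<close>
  have "\<exists>z. q \<in> S \<longrightarrow> i < r q \<longrightarrow> int q dvd int p * z - y q i" for q i
  proof (cases "q = p \<or> q \<notin> S")
    case True
    then show ?thesis using y_p by (auto intro!: exI[of _ 0])
  next
    case False
    then have "\<not> int q dvd int p"
      using primes_dvd_imp_eq[of q p] prime_S pj by auto
    with False show ?thesis using dvd_solve[OF prime_int, of q "int p" "- y q i"] by auto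
  qed
  then obtain z0 where z0: "\<And>q i. q \<in> S \<Longrightarrow> i < r q \<Longrightarrow> int q dvd int p * z0 q i - y q i" by metis
  define z where "z = red z0"
  have z: "int q dvd int p * z q i - y q i" if "q \<in> S" "i < r q" for q i
    using z0[OF that] that dvd_mod_diff_iff(2)[of "int q" "int p" "z0 q i" "- y q i"] by (simp add: z_def)
  have "z \<in> A"
    by (rule isolated_divide[OF A _ y, of z "int p" 1])
      (use z pj in \<open>auto simp: z_def null_def dest: pos_S\<close>)
  have pow_z: "z [^]\<^bsub>sub A\<^esub> p = y"
  proof (rule P_eqI)
    show "z [^]\<^bsub>sub A\<^esub> p \<in> P" "y \<in> P" using y isolated_subset[OF A] by (auto simp: pow_sub_in_P)
    fix q i assume qi: "q \<in> S" "i < r q"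
    show "int q dvd (z [^]\<^bsub>sub A\<^esub> p) q i - y q i"
      using dvd_add[OF pow_sub[OF qi, where x = z and A = A and n = p] z[OF qi]] by simp
  qed
  have g_eq: "?g = y \<otimes>\<^bsub>sub A\<^esub> (h [^]\<^bsub>sub A\<^esub> a p)"
  proof (rule P_eqI)
    fix q i assume qi: "q \<in> S" "i < r q"
    have "int q dvd (h [^]\<^bsub>sub A\<^esub> a p) q i - int (a p) * h q i" using pow_sub[OF qi] .
    moreover have "int q dvd y q i - (int (a q) * h q i - int (a p) * h q i)"
      using qi by (simp add: y_def dvd_eq_mod_eq_0 mod_simps)
    ultimately have "int q dvd ((h [^]\<^bsub>sub A\<^esub> a p) q i - int (a p) * h q i)
        + (y q i - (int (a q) * h q i - int (a p) * h q i))" by (rule dvd_add)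
    then have "int q dvd int (a q) * h q i - (y q i + (h [^]\<^bsub>sub A\<^esub> a p) q i)"
      by (subst dvd_minus_iff[symmetric]) (simp add: algebra_simps)
    then show "int q dvd ?g q i - (y \<otimes>\<^bsub>sub A\<^esub> (h [^]\<^bsub>sub A\<^esub> a p)) q i"
      using qi by (simp add: mult_sub dvd_eq_mod_eq_0 mod_simps)
  qed (simp_all add: mult_sub)
  have "\<phi> ?g = \<phi> z [^]\<^bsub>sub B\<^esub> p \<otimes>\<^bsub>sub B\<^esub> \<phi> h [^]\<^bsub>sub B\<^esub> a p"
  proof -
    have car: "z \<in> carrier (sub A)" "h \<in> carrier (sub A)" using \<open>z \<in> A\<close> h by simp_all
    show ?thesis
      unfolding g_eq pow_z[symmetric] \<phi>.hom_mult[OF A.nat_pow_closed[OF car(1)] A.nat_pow_closed[OF car(2)]]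
        \<phi>.hom_nat_pow[OF car(1)] \<phi>.hom_nat_pow[OF car(2)] ..
  qed
  then have "int p dvd \<phi> ?g p j - ((\<phi> z [^]\<^bsub>sub B\<^esub> p) p j + (\<phi> h [^]\<^bsub>sub B\<^esub> a p) p j)"
    using pj by (simp add: mult_sub dvd_mod_diff_iff)
  moreover have "int p dvd (\<phi> z [^]\<^bsub>sub B\<^esub> p) p j - int p * \<phi> z p j"
    "int p dvd (\<phi> h [^]\<^bsub>sub B\<^esub> a p) p j - int (a p) * \<phi> h p j"
    by (rule pow_sub[OF pj])+
  moreover have "int p dvd int p * \<phi> z p j" by simp
  ultimately have "int p dvd (\<phi> ?g p j - ((\<phi> z [^]\<^bsub>sub B\<^esub> p) p j + (\<phi> h [^]\<^bsub>sub B\<^esub> a p) p j))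
      + ((\<phi> z [^]\<^bsub>sub B\<^esub> p) p j - int p * \<phi> z p j)
      + ((\<phi> h [^]\<^bsub>sub B\<^esub> a p) p j - int (a p) * \<phi> h p j) + int p * \<phi> z p j"
    by (intro dvd_add)
  then have "int p dvd \<phi> ?g p j - int (a p) * \<phi> h p j" by simp
  then show "int p dvd \<phi> ?g p j - red (\<lambda>p j. int (a p) * \<phi> h p j) p j"
    using pj by (simp add: dvd_eq_mod_eq_0 mod_simps)
qed simp

section \<open>The two groups, their mutual embeddings and their non-isomorphism\<close>

definition big :: "(nat \<Rightarrow> nat \<Rightarrow> int) set" where
  "big = poly_span UNIV"

definition small :: "(nat \<Rightarrow> nat \<Rightarrow> int) set" where
  "small = poly_span {f. coeff f 1 = 0}"

lemma isolated_big: "isolated big"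
  unfolding big_def by (rule isolated_poly_span) auto

lemma isolated_small: "isolated small"
  unfolding small_def by (rule isolated_poly_span) auto

lemma small_embeds_big: "\<exists>f. elementary_embedding (sub small) (sub big) f"
  by (rule exI, rule isolated_elementary[OF isolated_small isolated_big])
    (simp add: small_def big_def poly_span_mono)

text \<open>Multiplication by the squared logarithm maps \<open>big\<close> isomorphically onto the
  span of the polynomials divisible by the square of the variable. These have no linear term, so the
  span is an isolated subset of \<open>small\<close>.\<close>

lemma big_embeds_small: "\<exists>f. elementary_embedding (sub big) (sub small) f"
proof -
  let ?J = "range (\<lambda>f :: int poly. pCons 0 (pCons 0 f))"
  let ?C = "poly_span ?J"
  let ?x = "\<lambda>p. int (floor_log p)"
  let ?\<mu> = "\<lambda>h. red (\<lambda>p j. ?x p ^ 2 * h p j)"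
  have C: "isolated ?C"
  proof (rule isolated_poly_span)
    have "0 = pCons 0 (pCons 0 (0 :: int poly))" by simp
    then show "0 \<in> ?J" by blast
    fix f g :: "int poly" and k l :: int
    assume "f \<in> ?J" "g \<in> ?J"
    then obtain f' g' where "f = pCons 0 (pCons 0 f')" "g = pCons 0 (pCons 0 g')" by blast
    then have "smult k f + smult l g = pCons 0 (pCons 0 (smult k f' + smult l g'))" by simp
    then show "smult k f + smult l g \<in> ?J" by blast
  qed
  have unit: "\<not> int p dvd ?x p ^ 2" if "p \<in> S" for p
    using not_dvd_floor_log[OF that] prime_dvd_power[OF prime_int[OF that]] by blast
  have cancel: "int p dvd ?x p ^ 2 * u \<longleftrightarrow> int p dvd u" if "p \<in> S" for p u
    using unit[OF that] prime_dvd_mult_iff[OF prime_int[OF that]] by blast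
  have \<mu>_C: "?\<mu> h \<in> ?C" if h: "h \<in> big" for h
  proof -
    obtain f n where f: "n \<noteq> 0" "null (\<lambda>p j. n * h p j - poly f (?x p))"
      using h by (auto simp: big_def poly_span_def)
    show ?thesis
    proof (rule poly_spanI[OF _ rangeI f(1)])
      show "null (\<lambda>p j. n * ?\<mu> h p j - poly (pCons 0 (pCons 0 f)) (?x p))"
      proof (rule null_combine[OF f(2) f(2)])
        fix p j assume pj: "p \<in> S" "j < r p" and "int p dvd n * h p j - poly f (?x p)"
        then have "int p dvd ?x p ^ 2 * (n * h p j - poly f (?x p))" by simp
        also have "\<dots> = n * (?x p ^ 2 * h p j) + - poly (pCons 0 (pCons 0 f)) (?x p)"
          by (simp add: algebra_simps power2_eq_square)
        finally have "int p dvd n * ?\<mu> h p j + - poly (pCons 0 (pCons 0 f)) (?x p)"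
          using pj by (simp only: red_apply dvd_mod_diff_iff(2))
        then show "int p dvd n * ?\<mu> h p j - poly (pCons 0 (pCons 0 f)) (?x p)" by simp
      qed
    qed simp
  qed
  have "?\<mu> \<in> iso (sub big) (sub ?C)"
    unfolding iso_iff carrier_sub
  proof (intro conjI)
    show "?\<mu> \<in> hom (sub big) (sub ?C)"
    proof (rule homI)
      show "?\<mu> (x \<otimes>\<^bsub>sub big\<^esub> y) = ?\<mu> x \<otimes>\<^bsub>sub ?C\<^esub> ?\<mu> y" for x y
        by (rule P_eqI) (simp_all add: mult_sub dvd_eq_mod_eq_0 mod_simps distrib_left)
    qed (simp add: \<mu>_C)
    show "inj_on ?\<mu> big"
    proof (rule inj_onI)
      fix h h' assume hh: "h \<in> big" "h' \<in> big" "?\<mu> h = ?\<mu> h'"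
      show "h = h'"
      proof (rule P_eqI)
        show "h \<in> P" "h' \<in> P" using hh isolated_subset[OF isolated_big] by auto
        fix p j assume pj: "p \<in> S" "j < r p"
        then have "?x p ^ 2 * h p j mod int p = ?x p ^ 2 * h' p j mod int p"
          using fun_cong[OF fun_cong[OF hh(3), of p], of j] by simp
        then have "int p dvd ?x p ^ 2 * (h p j - h' p j)"
          by (simp add: mod_eq_dvd_iff right_diff_distrib)
        then show "int p dvd h p j - h' p j" using cancel pj by blast
      qed
    qed
    show "?\<mu> ` big = ?C"
    proof (intro equalityI subsetI)
      fix h assume "h \<in> ?C"
      then obtain f n where h: "h \<in> P" and n: "n \<noteq> 0"
        and f: "null (\<lambda>p j. n * h p j - poly (pCons 0 (pCons 0 f)) (?x p))"
        by (auto simp: poly_span_def)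
      \<comment> \<open>For surjectivity, \<open>h\<close> is divided componentwise by the squared
        logarithm, a unit; the quotient has numerator \<open>f\<close>.\<close>
      have "\<exists>y. p \<in> S \<longrightarrow> int p dvd ?x p ^ 2 * y + - h p j" for p j
        using dvd_solve[OF prime_int unit] by blast
      then obtain y0 where y0: "\<And>p j. p \<in> S \<Longrightarrow> int p dvd ?x p ^ 2 * y0 p j + - h p j" by metis
      define y where "y = red y0"
      have y: "int p dvd ?x p ^ 2 * y p j - h p j" if "p \<in> S" "j < r p" for p j
        using y0[OF that(1), of j] that dvd_mod_diff_iff(2)[of "int p" "?x p ^ 2" "y0 p j" "- h p j"]
        by (simp add: y_def)
      have "y \<in> big" unfolding big_def
      proof (rule poly_spanI[OF _ UNIV_I n])
        show "null (\<lambda>p j. n * y p j - poly f (?x p))"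
        proof (rule null_combine[OF f f])
          fix p j assume pj: "p \<in> S" "j < r p"
            and "int p dvd n * h p j - poly (pCons 0 (pCons 0 f)) (?x p)"
          then have "int p dvd (n * h p j - poly (pCons 0 (pCons 0 f)) (?x p))
              + n * (?x p ^ 2 * y p j - h p j)"
            using y[OF pj] by (intro dvd_add dvd_mult)
          also have "\<dots> = ?x p ^ 2 * (n * y p j - poly f (?x p))"
            by (simp add: algebra_simps power2_eq_square)
          finally show "int p dvd n * y p j - poly f (?x p)" using cancel pj by blast
        qed
      qed (simp add: y_def)
      moreover have "?\<mu> y = h"
        using h y by (intro P_eqI) (auto simp: dvd_mod_diff_iff(1))
      ultimately show "h \<in> ?\<mu> ` big" by blast
    qed (use \<mu>_C in blast)
  qed
  then have "elementary_embedding (sub big) (sub ?C) ?\<mu>"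
    by (rule elementary_embedding_iso[OF fo_structure_sub[OF isolated_big]])
  moreover have "elementary_embedding (sub ?C) (sub small) id"
    by (rule isolated_elementary[OF C isolated_small])
      (unfold small_def, rule poly_span_mono, auto)
  ultimately show ?thesis using elementary_embedding_trans by blast
qed

lemma not_iso: "\<not> sub big \<cong> sub small"
proof
  let ?x = "\<lambda>p. int (floor_log p)"
  let ?scale = "\<lambda>h. red (\<lambda>p j. ?x p * h p j)"
  assume "sub big \<cong> sub small"
  then obtain \<phi> where \<phi>: "\<phi> \<in> hom (sub big) (sub small)" "\<phi> ` big = small"
    by (auto simp: is_iso_def iso_iff)
  have one: "red (\<lambda>_ _. 1) \<in> small"
    unfolding small_def by (rule poly_spanI[of _ 1 _ 1]) (auto simp: null_def dvd_mod_diff_iff)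
  \<comment> \<open>Scaling by the logarithm stays in \<open>big\<close> and commutes with
    \<open>\<phi>\<close>, so a preimage of 1 forces the logarithm sequence itself into
    \<open>small\<close>.\<close>
  then obtain h where h: "h \<in> big" "\<phi> h = red (\<lambda>_ _. 1)" using \<phi>(2) by force
  have scale: "?scale h \<in> big"
  proof -
    obtain f n where f: "n \<noteq> 0" "null (\<lambda>p j. n * h p j - poly f (?x p))"
      using h(1) by (auto simp: big_def poly_span_def)
    show ?thesis unfolding big_def
    proof (rule poly_spanI[OF _ UNIV_I f(1)])
      show "null (\<lambda>p j. n * ?scale h p j - poly (pCons 0 f) (?x p))"
      proof (rule null_combine[OF f(2) f(2)])
        fix p j assume pj: "p \<in> S" "j < r p" and "int p dvd n * h p j - poly f (?x p)"
        then have "int p dvd ?x p * (n * h p j - poly f (?x p))" by simp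
        also have "\<dots> = n * (?x p * h p j) + - poly (pCons 0 f) (?x p)"
          by (simp add: algebra_simps)
        finally have "int p dvd n * ?scale h p j + - poly (pCons 0 f) (?x p)"
          using pj by (simp only: red_apply dvd_mod_diff_iff(2))
        then show "int p dvd n * ?scale h p j - poly (pCons 0 f) (?x p)" by simp
      qed
    qed simp
  qed
  have "\<phi> (?scale h) \<in> small" using \<phi>(2) scale by blast
  then have "?scale (red (\<lambda>_ _. 1)) \<in> small"
    using hom_scale[OF isolated_big isolated_small \<phi>(1) h(1), of floor_log] scale h(2) by simp
  then obtain f n where f: "coeff f 1 = 0" and n: "n \<noteq> 0"
    and null: "null (\<lambda>p j. n * ?scale (red (\<lambda>_ _. 1)) p j - poly f (?x p))"
    by (auto simp: small_def poly_span_def)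
  \<comment> \<open>As \<open>f\<close> has no linear term, \<open>f - [:0, n:]\<close> has linear
    coefficient \<open>- n\<close> and is nonzero; its vanishing modulo almost all primes of
    \<open>S\<close> contradicts transcendence.\<close>
  have "null (\<lambda>p j. poly (f - [:0, n:]) (?x p))"
  proof (rule null_combine[OF null null])
    fix p j assume pj: "p \<in> S" "j < r p"
      and "int p dvd n * ?scale (red (\<lambda>_ _. 1)) p j - poly f (?x p)"
    then have "int p dvd n * ?scale (red (\<lambda>_ _. 1)) p j + - poly f (?x p)" by simp
    then have "int p dvd n * (?x p * red (\<lambda>_ _. 1) p j) + - poly f (?x p)"
      using pj by (simp only: red_apply dvd_mod_diff_iff(2))
    then have "int p dvd n * ?x p * (1 mod int p) + - poly f (?x p)"
      using pj by (simp add: mult.assoc)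
    then have "int p dvd n * ?x p * 1 + - poly f (?x p)" by (simp only: dvd_mod_diff_iff(2))
    then have "int p dvd - (n * ?x p * 1 + - poly f (?x p))" by (simp only: dvd_minus_iff)
    then show "int p dvd poly (f - [:0, n:]) (?x p)" by (simp add: algebra_simps)
  qed
  then obtain K where K: "\<And>p j. p \<in> S \<Longrightarrow> K < p \<Longrightarrow> j < r p \<Longrightarrow> int p dvd poly (f - [:0, n:]) (?x p)"
    unfolding null_def by blast
  have "coeff (f - [:0, n:]) 1 \<noteq> 0" using f n by simp
  then have "f - [:0, n:] \<noteq> 0" by (metis coeff_0)
  then obtain L where L: "\<And>p. p > L \<Longrightarrow> \<not> int p dvd poly (f - [:0, n:]) (?x p)"
    using floor_log_transcendental by blast
  obtain p where "p \<in> S" "max K L < p" using infinite_S by (meson infinite_nat_iff_unbounded)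
  then show False using K[of p 0] L[of p] r_pos[of p] by auto
qed

end

section \<open>Transfer of both groups to a universe of at least continuum size\<close>

theorem theorem3p9:
  fixes S :: "nat set" and r :: "nat \<Rightarrow> nat"
  assumes "infinite S"
    and "\<And>p. p \<in> S \<Longrightarrow> prime p"
    and "\<And>p. p \<in> S \<Longrightarrow> r p > 0"
    and "(UNIV :: nat set set) \<lesssim> (UNIV :: 'u set)"
  shows "\<not> schroeder_bernstein TYPE('u) (Th (prime_sum_group S r)) \<and>
    (\<exists>(M :: 'u monoid) (N :: 'u monoid).
       model_of (Th (prime_sum_group S r)) M \<and> reduced_group M \<and>
       model_of (Th (prime_sum_group S r)) N \<and> reduced_group N \<and>
       elementarily_biembeddable M N \<and> \<not> M \<cong> N)"
proof -
  interpret prime_family S r using assms(1-3) by unfold_locales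
  obtain g :: "(nat \<Rightarrow> nat \<Rightarrow> int) \<Rightarrow> 'u" where g: "inj g"
    using inj_integer_functions[OF assms(4)] by blast
  let ?T = "\<lambda>A. transport g (sub A)"
  have to: "elementary_embedding (sub A) (?T A) g" if "isolated A" for A
    using elementary_embedding_iso[OF fo_structure_sub[OF that] transport_iso[OF g]] .
  have iso: "inv_into A g \<in> iso (?T A) (sub A)" if "isolated A" for A
    using group.iso_set_sym[OF _ transport_iso[OF g], of "sub A"] comm_group_sub[OF that]
    by (simp add: comm_group_def)
  have from_T: "elementary_embedding (?T A) (sub A) (inv_into A g)" if "isolated A" for A
    using elementary_embedding_iso[OF fo_structure_transport[OF g fo_structure_sub[OF that]] iso[OF that]] .
  have model: "model_of (Th (prime_sum_group S r)) (?T A)" if "isolated A" "direct_sum \<subseteq> A" for A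
    unfolding prime_sum_group_eq
    using model_of_Th_elementary_embedding[OF fo_structure_sub[OF isolated_direct_sum]
        fo_structure_transport[OF g fo_structure_sub[OF that(1)]]
        elementary_embedding_trans[OF isolated_elementary[OF isolated_direct_sum that] to[OF that(1)]]] .
  \<comment> \<open>A null element agrees with zero modulo the direct sum, so isolation applied to
    the zero element yields it.\<close>
  have sum_sub: "direct_sum \<subseteq> A" if "isolated A" for A
  proof
    fix h assume "h \<in> direct_sum"
    then show "h \<in> A"
      using isolated_divide[OF that _ isolated_zero[OF that], of h 1 0] by (simp add: direct_sum_def)
  qed
  have emb: "\<exists>f. elementary_embedding (?T A) (?T B) f"
    if AB: "isolated A" "isolated B" "\<exists>f. elementary_embedding (sub A) (sub B) f" for A B
  proof -
    obtain f where "elementary_embedding (sub A) (sub B) f" using AB(3) by blast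
    then show ?thesis
      using elementary_embedding_trans[OF elementary_embedding_trans[OF from_T[OF AB(1)]] to[OF AB(2)]]
      by blast
  qed
  have "elementarily_biembeddable (?T big) (?T small)"
    unfolding elementarily_biembeddable_def
    using emb[OF isolated_big isolated_small big_embeds_small]
      emb[OF isolated_small isolated_big small_embeds_big] by (rule conjI)
  moreover have "\<not> ?T big \<cong> ?T small"
  proof
    assume "?T big \<cong> ?T small"
    then have "sub big \<cong> sub small"
      using iso_trans[OF iso_trans[OF is_isoI[OF transport_iso[OF g]]] is_isoI[OF iso[OF isolated_small]]]
      by blast
    then show False using not_iso by blast
  qed
  moreover have "model_of (Th (prime_sum_group S r)) (?T big)" "model_of (Th (prime_sum_group S r)) (?T small)"
    by (rule model sum_sub isolated_big isolated_small)+
  moreover have "reduced_group (?T big)" "reduced_group (?T small)"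
    by (rule reduced_group_transport[OF g] reduced_group_sub isolated_big isolated_small)+
  ultimately have "\<exists>(M :: 'u monoid) (N :: 'u monoid).
       model_of (Th (prime_sum_group S r)) M \<and> reduced_group M \<and>
       model_of (Th (prime_sum_group S r)) N \<and> reduced_group N \<and>
       elementarily_biembeddable M N \<and> \<not> M \<cong> N"
    by (intro exI[of _ "?T big"] exI[of _ "?T small"] conjI)
  then show ?thesis by (auto simp: schroeder_bernstein_def)
qed

end
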